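(* Let $s$ be a complex number with $\Re(s)>2$, and let $c$ be a real number such that $c>1$ and $\Re(s)-c>1$. Then $$\frac{1}{2\pi i}\int_{c-i\infty}^{c+i\infty}\zeta(z)\,\zeta(s-z)\,\Gamma(z)\,\Gamma(s-z)\,dz=\int_{0}^{\infty}\frac{x^{s-1}\left(\coth\left(\frac{x}{2}\right)+1\right)}{2e^{x}(e^{x}-1)}\,dx .$$
   Context: $\Gamma$ is the Gamma function and $\zeta$ is the Riemann zeta function. The integral on the left is taken along the vertical line $\Re(z)=c$, oriented upwards. *)

theory Defs
  imports "HOL-Complex_Analysis.Complex_Analysis"
begin

definition zeta_series :: "complex \<Rightarrow> complex" where
  "zeta_series z = (\<Sum>n. 1 / of_nat (Suc n) powr z)"

text \<open>
  Outside the half-plane of convergence the value is that of the analytic continuation of the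
  Dirichlet series to the plane punctured at 1, which exists and is unique; the value at the
  pole is 0 by convention.
\<close>
definition zeta :: "complex \<Rightarrow> complex" where
  "zeta z =
     (if Re z > 1 then zeta_series z
      else if z = 1 then 0
      else (THE w. \<exists>f. f holomorphic_on (- {1}) \<and>
                       (\<forall>u. Re u > 1 \<longrightarrow> f u = zeta_series u) \<and> f z = w))"

definition coth :: "real \<Rightarrow> real" where
  "coth x = cosh x / sinh x"

text \<open>
  Parametrising the line \<open>Re z = c\<close> upwards by \<open>z = c + \<i> t\<close> gives \<open>dz = \<i> dt\<close>.
\<close>
definition vertical_line_integrable :: "real \<Rightarrow> (complex \<Rightarrow> complex) \<Rightarrow> bool" where
  "vertical_line_integrable c f \<longleftrightarrow>
     interval_lebesgue_integrable lborel (-\<infinity>) \<infinity> (\<lambda>t. f (Complex c t) * \<i>)"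

definition vertical_line_integral :: "real \<Rightarrow> (complex \<Rightarrow> complex) \<Rightarrow> complex" where
  "vertical_line_integral c f = (LBINT t=-\<infinity>..\<infinity>. f (Complex c t) * \<i>)"

end

theory Submission
  imports Defs "HOL-Probability.Probability"
begin

text \<open>
  On the line \<open>Re z = c\<close>, \<open>\<zeta>(z)\<Gamma>(z)\<close> is the Mellin transform of \<open>1 / (e\<^sup>x - 1)\<close>, and so is
  \<open>\<zeta>(s - z)\<Gamma>(s - z)\<close> on the reflected line, so Parseval's formula gives the integral of
  \<open>x\<^bsup>s-1\<^esup> / (e\<^sup>x - 1)\<^sup>2\<close>; and \<open>coth (x/2) + 1 = 2 e\<^sup>x / (e\<^sup>x - 1)\<close> identifies the integrands. With
  \<open>x = e\<^sup>v\<close> the Mellin transform becomes a Fourier transform. Writing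
  \<open>\<Gamma>(z) = \<Gamma>(z + 2) / (z (z + 1))\<close> and \<open>\<bar>\<Gamma>(z + 2)\<bar> \<le> \<Gamma>(c + 2)\<close> gives quadratic decay on the line, which
  is enough for Fourier inversion, and no Stirling estimate is needed.
\<close>

section \<open>Fourier inversion for integrable functions on the real line\<close>

text \<open>Supplies the dominating function for the uses of Fubini's theorem, where the integrand
  is such a product up to phases of modulus one.\<close>

lemma integrable_pair_mult:
  fixes f g :: "real \<Rightarrow> 'a::{real_normed_field, banach, second_countable_topology}"
  assumes f: "integrable lborel f" and g: "integrable lborel g"
  shows "integrable (lborel \<Otimes>\<^sub>M lborel) (\<lambda>(x, y). f x * g y)"
proof (rule lborel_pair.Fubini_integrable)
  have [measurable]: "f \<in> borel_measurable borel" "g \<in> borel_measurable borel"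
    using borel_measurable_integrable[OF f] borel_measurable_integrable[OF g] by simp_all
  show "(\<lambda>(x, y). f x * g y) \<in> borel_measurable (lborel \<Otimes>\<^sub>M lborel)" by measurable
  show "integrable lborel (\<lambda>x. LBINT y. norm (case (x, y) of (x, y) \<Rightarrow> f x * g y))"
    using integrable_norm[OF f] by (simp add: norm_mult)
  show "AE x in lborel. integrable lborel (\<lambda>y. case (x, y) of (x, y) \<Rightarrow> f x * g y)"
    using g by simp
qed

text \<open>The characteristic function of the standard normal law is
  \<open>exp (- b^2 / 2)\<close>; rescaling the variable by \<open>e\<close> gives the general
  width.\<close>

lemma gaussian_fourier:
  fixes e a :: real
  assumes "e > 0"
  shows "integrable lborel (\<lambda>t. exp (- (e * t)\<^sup>2 / 2))"
    and "(LBINT t. iexp (t * a) * of_real (exp (- (e * t)\<^sup>2 / 2))) =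
           of_real (sqrt (2 * pi) / e * exp (- (a / e)\<^sup>2 / 2))"
proof -
  have std: "exp (- t\<^sup>2 / 2) = sqrt (2 * pi) * std_normal_density t" for t :: real
    by (simp add: std_normal_density_def)
  have int: "integrable lborel (\<lambda>t::real. exp (- t\<^sup>2 / 2))"
    unfolding std by simp
  then show "integrable lborel (\<lambda>t. exp (- (e * t)\<^sup>2 / 2))"
    using lborel_integrable_real_affine[OF int, of e 0] assms by simp
  have 1: "(LBINT t. iexp (t * b) * of_real (exp (- t\<^sup>2 / 2))) =
      of_real (sqrt (2 * pi) * exp (- b\<^sup>2 / 2))" for b
  proof -
    have "of_real (exp (- b\<^sup>2 / 2)) = char std_normal_distribution b"
      by (simp add: char_std_normal_distribution)
    also have "\<dots> = (LBINT t. std_normal_density t *\<^sub>R iexp (b * t))"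
      unfolding char_def by (subst integral_density) (auto simp: normal_density_nonneg)
    finally have "of_real (sqrt (2 * pi) * exp (- b\<^sup>2 / 2)) =
        of_real (sqrt (2 * pi)) * (LBINT t. std_normal_density t *\<^sub>R iexp (b * t))"
      by simp
    also have "\<dots> = (LBINT t. of_real (sqrt (2 * pi)) * (std_normal_density t *\<^sub>R iexp (b * t)))"
      by (rule integral_mult_right_zero [symmetric])
    also have "\<dots> = (LBINT t. iexp (t * b) * of_real (exp (- t\<^sup>2 / 2)))"
      unfolding std by (simp add: scaleR_conv_of_real mult_ac)
    finally show ?thesis ..
  qed
  have "(LBINT t. iexp (t * (a / e)) * of_real (exp (- t\<^sup>2 / 2))) =
      \<bar>e\<bar> *\<^sub>R (LBINT t. iexp ((0 + e * t) * (a / e)) * of_real (exp (- (0 + e * t)\<^sup>2 / 2)))"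
    using assms by (subst lborel_integral_real_affine[where c = e and t = 0]) auto
  also have "(\<lambda>t. iexp ((0 + e * t) * (a / e)) * of_real (exp (- (0 + e * t)\<^sup>2 / 2))) =
      (\<lambda>t. iexp (t * a) * complex_of_real (exp (- (e * t)\<^sup>2 / 2)))"
    using assms by auto
  finally show "(LBINT t. iexp (t * a) * of_real (exp (- (e * t)\<^sup>2 / 2))) =
      of_real (sqrt (2 * pi) / e * exp (- (a / e)\<^sup>2 / 2))"
    unfolding 1 using assms by (simp add: scaleR_conv_of_real field_simps)
qed

text \<open>
  Damping \<open>\<phi>\<close> by a Gaussian and using Fubini turns the inverse transform into the convolution of
  \<open>h\<close> with an approximate identity.
\<close>
lemma fourier_inversion:
  fixes h :: "real \<Rightarrow> complex" and u :: real
  defines "\<phi> \<equiv> \<lambda>t::real. LBINT v. iexp (t * v) * h v"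
  assumes h: "integrable lborel h" and bdd: "\<And>v. norm (h v) \<le> B" and cont: "isCont h u"
    and \<phi>: "integrable lborel \<phi>"
  shows "(LBINT t. \<phi> t * iexp (- (t * u))) = 2 * of_real pi * h u"
proof -
  define e where "e n = 1 / real (Suc n)" for n
  have epos: "e n > 0" for n by (simp add: e_def)
  have elim: "e \<longlonglongrightarrow> 0"
    unfolding e_def by (rule LIMSEQ_Suc[OF lim_1_over_n])
  \<comment> \<open>The limit of \<open>A\<close> is found twice: by letting the damping disappear
    in \<open>lim1\<close>, and by the approximate identity in \<open>lim2\<close>.\<close>
  define A where "A n = (LBINT t. \<phi> t * iexp (- (t * u)) * of_real (exp (- (e n * t)\<^sup>2 / 2)))" for n
  have hm[measurable]: "h \<in> borel_measurable borel"
    using borel_measurable_integrable[OF h] by simp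
  have \<phi>m[measurable]: "\<phi> \<in> borel_measurable borel"
    using borel_measurable_integrable[OF \<phi>] by simp
  have lim1: "A \<longlonglongrightarrow> (LBINT t. \<phi> t * iexp (- (t * u)))"
    unfolding A_def
  proof (rule integral_dominated_convergence[where w = "\<lambda>t. norm (\<phi> t)"])
    show "AE t in lborel. (\<lambda>n. \<phi> t * iexp (- (t * u)) * of_real (exp (- (e n * t)\<^sup>2 / 2)))
        \<longlonglongrightarrow> \<phi> t * iexp (- (t * u))"
    proof (rule AE_I2)
      fix t
      have "(\<lambda>n. \<phi> t * iexp (- (t * u)) * of_real (exp (- (e n * t)\<^sup>2 / 2)))
        \<longlonglongrightarrow> \<phi> t * iexp (- (t * u)) * of_real (exp (- (0 * t)\<^sup>2 / 2))"
        by (intro tendsto_intros elim) simp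
      then show "(\<lambda>n. \<phi> t * iexp (- (t * u)) * of_real (exp (- (e n * t)\<^sup>2 / 2)))
        \<longlonglongrightarrow> \<phi> t * iexp (- (t * u))" by simp
    qed
    show "AE t in lborel. norm (\<phi> t * iexp (- (t * u)) * of_real (exp (- (e n * t)\<^sup>2 / 2)))
        \<le> norm (\<phi> t)" for n
      by (intro AE_I2) (simp add: norm_mult mult_left_le)
  qed (use \<phi> in \<open>auto intro: integrable_norm\<close>)
  have A_eq: "A n = of_real (sqrt (2 * pi)) *
      (LBINT w. h (u + e n * w) * of_real (exp (- w\<^sup>2 / 2)))" for n
  proof -
    let ?g = "\<lambda>t. exp (- (e n * t)\<^sup>2 / 2)"
    let ?F = "\<lambda>t v. iexp (t * v) * h v * (iexp (- (t * u)) * complex_of_real (?g t))"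
    \<comment> \<open>The phases have modulus one, so integrability in \<open>t\<close> is owed to
      the Gaussian and integrability in \<open>v\<close> to \<open>h\<close>.\<close>
    have int: "integrable (lborel \<Otimes>\<^sub>M lborel) (case_prod ?F)"
    proof (rule Bochner_Integration.integrable_bound)
      show "integrable (lborel \<Otimes>\<^sub>M lborel) (\<lambda>(t, v). complex_of_real (?g t) * h v)"
        using gaussian_fourier(1)[OF epos, of n] h by (intro integrable_pair_mult) simp_all
    qed (auto simp: norm_mult split_beta')
    have "A n = (LBINT t. (LBINT v. ?F t v))"
      unfolding A_def \<phi>_def integral_mult_left_zero by (simp only: mult.assoc)
    also have "\<dots> = (LBINT v. (LBINT t. ?F t v))"
      by (rule lborel_pair.Fubini_integral[OF int, symmetric])
    also have "\<dots> = (LBINT v. h v * of_real (sqrt (2 * pi) / e n * exp (- ((v - u) / e n)\<^sup>2 / 2)))"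
    proof (rule Bochner_Integration.integral_cong[OF refl])
      fix v
      have "(LBINT t. ?F t v) = (LBINT t. h v * (iexp (t * (v - u)) * of_real (?g t)))"
      proof (rule Bochner_Integration.integral_cong[OF refl])
        fix t
        have "iexp (t * v) * iexp (- (t * u)) = iexp (t * (v - u))"
          by (simp add: algebra_simps flip: exp_add)
        moreover have "?F t v = h v * ((iexp (t * v) * iexp (- (t * u))) * of_real (?g t))"
          by (simp only: mult_ac)
        ultimately show "?F t v = h v * (iexp (t * (v - u)) * of_real (?g t))"
          by (simp only:)
      qed
      then show "(LBINT t. ?F t v) =
          h v * of_real (sqrt (2 * pi) / e n * exp (- ((v - u) / e n)\<^sup>2 / 2))"
        using gaussian_fourier(2)[OF epos[of n], of "v - u"] by simp
    qed
    \<comment> \<open>Substituting \<open>v = u + e n * w\<close> cancels \<open>1 / e n\<close> and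
      leaves a Gaussian in \<open>w\<close> independent of \<open>n\<close>, so that only the
      argument of \<open>h\<close> moves.\<close>
    also have "\<dots> = \<bar>e n\<bar> *\<^sub>R (LBINT w. h (u + e n * w) *
        of_real (sqrt (2 * pi) / e n * exp (- ((u + e n * w - u) / e n)\<^sup>2 / 2)))"
      using epos[of n] by (subst lborel_integral_real_affine[where c = "e n" and t = u]) auto
    also have "(\<lambda>w. h (u + e n * w) *
        of_real (sqrt (2 * pi) / e n * exp (- ((u + e n * w - u) / e n)\<^sup>2 / 2))) =
        (\<lambda>w. of_real (sqrt (2 * pi) / e n) * (h (u + e n * w) * of_real (exp (- w\<^sup>2 / 2))))"
      using epos[of n] by (auto simp: field_simps)
    finally show ?thesis
      using epos[of n] by (simp add: scaleR_conv_of_real)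
  qed
  \<comment> \<open>Continuity at \<open>u\<close> gives the pointwise limit, and the bound
    \<open>B\<close> an integrable majorant.\<close>
  have lim2: "A \<longlonglongrightarrow> of_real (sqrt (2 * pi)) * (LBINT w. h u * of_real (exp (- w\<^sup>2 / 2)))"
    unfolding A_eq
  proof (intro tendsto_mult_left integral_dominated_convergence[where w = "\<lambda>w. B * exp (- w\<^sup>2 / 2)"])
    show "AE w in lborel. (\<lambda>n. h (u + e n * w) * of_real (exp (- w\<^sup>2 / 2)))
        \<longlonglongrightarrow> h u * of_real (exp (- w\<^sup>2 / 2))"
    proof (rule AE_I2)
      fix w
      have "(\<lambda>n. u + e n * w) \<longlonglongrightarrow> u + 0 * w"
        by (intro tendsto_intros elim)
      then have "(\<lambda>n. h (u + e n * w)) \<longlonglongrightarrow> h u"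
        by (intro isCont_tendsto_compose[OF cont]) simp
      then show "(\<lambda>n. h (u + e n * w) * of_real (exp (- w\<^sup>2 / 2)))
        \<longlonglongrightarrow> h u * of_real (exp (- w\<^sup>2 / 2))" by (intro tendsto_intros)
    qed
    show "AE w in lborel. norm (h (u + e n * w) * of_real (exp (- w\<^sup>2 / 2))) \<le> B * exp (- w\<^sup>2 / 2)" for n
      by (intro AE_I2) (simp add: norm_mult bdd mult_right_mono)
    show "integrable lborel (\<lambda>w. B * exp (- w\<^sup>2 / 2))"
      using gaussian_fourier(1)[of 1] by simp
  qed auto
  \<comment> \<open>The Gaussian mass is the transform at frequency 0; with the equal factor in
    \<open>A_eq\<close> it produces \<open>2 * pi\<close>.\<close>
  have "(LBINT w. h u * of_real (exp (- w\<^sup>2 / 2))) = h u * of_real (sqrt (2 * pi))"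
    using gaussian_fourier(2)[of 1 0] by simp
  then have "of_real (sqrt (2 * pi)) * (LBINT w. h u * of_real (exp (- w\<^sup>2 / 2))) =
      of_real (sqrt (2 * pi) * sqrt (2 * pi)) * h u" by (simp only: of_real_mult mult_ac)
  also have "sqrt (2 * pi) * sqrt (2 * pi) = 2 * pi" by simp
  finally have "of_real (sqrt (2 * pi)) * (LBINT w. h u * of_real (exp (- w\<^sup>2 / 2))) =
      2 * of_real pi * h u" by simp
  with LIMSEQ_unique[OF lim1 lim2] show ?thesis by simp
qed

section \<open>Euler's integral for Gamma after an exponential substitution\<close>

text \<open>Change of variables \<open>x = exp v\<close>. The underlying rule speaks of absolute
  integrability for the completed measure; Borel measurability of the integrands carries it over to
  \<open>lborel\<close>.\<close>

lemma exp_substitution: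
  fixes f :: "real \<Rightarrow> complex"
  assumes m[measurable]: "f \<in> borel_measurable borel"
  shows "set_integrable lborel {0<..} f \<longleftrightarrow> integrable lborel (\<lambda>v. of_real (exp v) * f (exp v))"
    and "integrable lborel (\<lambda>v. of_real (exp v) * f (exp v)) \<Longrightarrow>
           (LBINT x:{0<..}. f x) = (LBINT v. of_real (exp v) * f (exp v))"
proof -
  have range: "range (exp :: real \<Rightarrow> real) = {0<..}"
    by (auto simp: image_iff) (metis exp_ln)
  have ab: "(\<lambda>v. \<bar>exp v\<bar> *\<^sub>R f (exp v)) absolutely_integrable_on UNIV \<longleftrightarrow>
      integrable lborel (\<lambda>v. of_real (exp v) * f (exp v))"
    unfolding set_integrable_def
    by (subst integrable_completion) (auto simp: scaleR_conv_of_real)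
  have "set_integrable lborel {0<..} f \<longleftrightarrow> f absolutely_integrable_on {0<..}"
    unfolding set_integrable_def by (subst integrable_completion) auto
  also have "\<dots> \<longleftrightarrow> (\<lambda>v. \<bar>exp v\<bar> *\<^sub>R f (exp v)) absolutely_integrable_on UNIV"
    using absolutely_integrable_change_of_variables_real[of UNIV exp exp f]
    by (auto simp: range inj_on_def intro!: derivative_eq_intros)
  finally show iff: "set_integrable lborel {0<..} f \<longleftrightarrow>
      integrable lborel (\<lambda>v. of_real (exp v) * f (exp v))"
    using ab by simp
  assume int: "integrable lborel (\<lambda>v. of_real (exp v) * f (exp v))"
  have "(LBINT x:{0<..}. f x) = integral {0<..} f"
    using int iff set_borel_integral_eq_integral(2) by blast
  also have "\<dots> = integral UNIV (\<lambda>v. \<bar>exp v\<bar> *\<^sub>R f (exp v))"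
    using has_absolute_integral_change_of_variables_real[of UNIV exp exp f] ab int
    by (auto simp: range inj_on_def intro!: derivative_eq_intros)
  also have "\<dots> = (LBINT v. of_real (exp v) * f (exp v))"
    using integral_lborel[OF int] by (simp add: scaleR_conv_of_real)
  finally show "(LBINT x:{0<..}. f x) = (LBINT v. of_real (exp v) * f (exp v))" .
qed

text \<open>Euler's integral under \<open>t = exp v\<close> is the case \<open>a = 1\<close>;
  translating \<open>v\<close> by \<open>ln a\<close> then multiplies \<open>exp v\<close> by
  \<open>a\<close> and brings out the factor \<open>a powr z\<close>.\<close>

lemma Gamma_exp_integral:
  fixes z :: complex and a :: real
  assumes z: "Re z > 0" and a: "a > 0"
  shows "integrable lborel (\<lambda>v. exp (z * of_real v) * of_real (exp (- (a * exp v))))" (is ?int)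
    and "(LBINT v. exp (z * of_real v) * of_real (exp (- (a * exp v)))) =
           Gamma z / of_real a powr z" (is ?eq)
proof -
  let ?f = "\<lambda>t. complex_of_real t powr (z - 1) / of_real (exp t)"
  let ?g = "\<lambda>v. exp (z * complex_of_real v) * of_real (exp (- exp v))"
  \<comment> \<open>The Jacobian \<open>exp v\<close> raises the exponent from \<open>z - 1\<close>
    to \<open>z\<close>.\<close>
  have fg: "(\<lambda>v. of_real (exp v) * ?f (exp v)) = ?g"
    by (auto simp: powr_def Ln_of_real algebra_simps exp_diff exp_minus divide_inverse
          simp flip: exp_of_real)
  have abs: "?f absolutely_integrable_on {0<..}"
    by (rule absolutely_integrable_Gamma_integral'[OF z])
  then have f: "set_integrable lborel {0<..} ?f"
    unfolding set_integrable_def by (subst (asm) integrable_completion) auto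
  then have g: "integrable lborel ?g"
    using exp_substitution(1)[of ?f] fg by simp
  have "(LBINT v. ?g v) = (LBINT x:{0<..}. ?f x)"
    using exp_substitution(2)[of ?f] fg g by simp
  also have "\<dots> = integral {0<..} ?f"
    using f set_borel_integral_eq_integral(2) by blast
  also have "\<dots> = Gamma z"
    using Gamma_integral_complex'[OF z] by (rule integral_unique)
  finally have Gamma: "(LBINT v. ?g v) = Gamma z" .
  have shift: "?g (ln a + 1 * v) =
      of_real a powr z * (exp (z * of_real v) * of_real (exp (- (a * exp v))))" for v
    using a by (simp add: powr_def Ln_of_real exp_add ring_distribs)
  have az: "of_real a powr z \<noteq> 0"
    using a by (simp add: powr_def)
  have "integrable lborel (\<lambda>v. inverse (of_real a powr z) * ?g (ln a + 1 * v))"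
    using lborel_integrable_real_affine[OF g, of 1 "ln a"] by simp
  then show ?int
    unfolding shift using az by (simp flip: mult.assoc)
  have "Gamma z = of_real a powr z * (LBINT v. exp (z * of_real v) * of_real (exp (- (a * exp v))))"
    using Gamma lborel_integral_real_affine[of 1 ?g "ln a"] unfolding shift by simp
  then show ?eq using az by (simp add: field_simps)
qed

text \<open>Evaluates the norm integrals belonging to \<open>Gamma_exp_integral\<close>, because
  \<open>exp (z * v)\<close> has modulus \<open>exp (Re z * v)\<close>.\<close>

lemma real_Gamma_exp_integral:
  fixes r a :: real
  assumes "r > 0" and "a > 0"
  shows "(LBINT v. exp (r * v) * exp (- (a * exp v))) = Gamma r / a powr r"
proof -
  have eq: "exp (complex_of_real r * of_real v) * of_real (exp (- (a * exp v))) =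
      of_real (exp (r * v) * exp (- (a * exp v)))" for v
    by (simp flip: exp_of_real)
  have "complex_of_real (LBINT v. exp (r * v) * exp (- (a * exp v))) =
      Gamma (of_real r) / of_real a powr of_real r"
    using Gamma_exp_integral(2)[of "of_real r" a] assms
    unfolding eq integral_complex_of_real by simp
  also have "\<dots> = of_real (Gamma r / a powr r)"
    using assms by (simp add: Gamma_complex_of_real powr_of_real)
  finally show ?thesis by (simp only: of_real_eq_iff)
qed

section \<open>Decay of Gamma on vertical lines\<close>

text \<open>Triangle inequality for Euler's integral: the modulus of the integrand at
  \<open>z\<close> is the integrand at \<open>Re z\<close>.\<close>

lemma norm_Gamma_le:
  fixes z :: complex
  assumes "Re z > 0"
  shows "norm (Gamma z) \<le> Gamma (Re z)"
proof -
  have "norm (Gamma z) = norm (LBINT v. exp (z * of_real v) * of_real (exp (- (1 * exp v))))"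
    using Gamma_exp_integral(2)[OF assms, of 1] by simp
  also have "\<dots> \<le> (LBINT v. norm (exp (z * of_real v) * of_real (exp (- (1 * exp v)))))"
    by (rule integral_norm_bound)
  also have "\<dots> = Gamma (Re z)"
    using real_Gamma_exp_integral[of "Re z" 1] assms by (simp add: norm_mult)
  finally show ?thesis .
qed

text \<open>After two uses of the functional equation, \<open>c \<ge> 1\<close> keeps both
  \<open>z\<close> and \<open>z + 1\<close> at modulus at least
  \<open>sqrt (1 + t^2)\<close>.\<close>

lemma norm_Gamma_vertical_le:
  fixes c t :: real
  assumes "c \<ge> 1"
  shows "norm (Gamma (Complex c t)) \<le> Gamma (c + 2) * inverse (1 + t\<^sup>2)"
proof -
  let ?z = "Complex c t"
  have nonpos: "?z \<notin> \<int>\<^sub>\<le>\<^sub>0" "?z + 1 \<notin> \<int>\<^sub>\<le>\<^sub>0"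
    using assms by (auto elim!: nonpos_Ints_cases simp: complex_eq_iff)
  have "Gamma (?z + 2) = (?z + 1) * (?z * Gamma ?z)"
    using Gamma_plus1[OF nonpos(1)] Gamma_plus1[OF nonpos(2)] by (simp add: add.assoc)
  then have "norm (?z + 1) * norm ?z * norm (Gamma ?z) = norm (Gamma (?z + 2))"
    by (simp add: norm_mult)
  also have "\<dots> \<le> Gamma (c + 2)"
    using norm_Gamma_le[of "?z + 2"] assms by simp
  finally have le: "norm (?z + 1) * norm ?z * norm (Gamma ?z) \<le> Gamma (c + 2)" .
  have "1 \<le> c\<^sup>2" "1 \<le> (c + 1)\<^sup>2"
    using assms by (simp_all add: one_le_power)
  then have "sqrt (1 + t\<^sup>2) \<le> norm ?z" "sqrt (1 + t\<^sup>2) \<le> norm (?z + 1)"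
    by (simp_all add: cmod_def)
  then have "sqrt (1 + t\<^sup>2) * sqrt (1 + t\<^sup>2) \<le> norm (?z + 1) * norm ?z"
    by (intro mult_mono) auto
  then have "(1 + t\<^sup>2) * norm (Gamma ?z) \<le> norm (?z + 1) * norm ?z * norm (Gamma ?z)"
    by (intro mult_right_mono) auto
  with le have "(1 + t\<^sup>2) * norm (Gamma ?z) \<le> Gamma (c + 2)" by linarith
  moreover have "1 + t\<^sup>2 > 0" by (simp add: add_pos_nonneg)
  ultimately show ?thesis by (simp add: field_simps)
qed

section \<open>Dirichlet series of zeta and the Mellin transform of
  \<open>1 / (exp x - 1)\<close>\<close>

lemma norm_zeta_term: "norm (1 / of_nat (Suc n) powr z) = real (Suc n) powr (- Re z)"
  using norm_powr_real_powr[of "of_nat (Suc n)" z]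
  by (simp add: norm_divide powr_minus_divide del: of_nat_Suc)

lemma summable_zeta_terms:
  assumes "r > 1"
  shows "summable (\<lambda>n. real (Suc n) powr (- r))"
  using assms summable_Suc_iff[of "\<lambda>n. real n powr (- r)"] by (simp add: summable_real_powr_iff)

lemma zeta_sums:
  assumes "Re z > 1"
  shows "(\<lambda>n. 1 / of_nat (Suc n) powr z) sums zeta z"
proof -
  have "summable (\<lambda>n. norm (1 / of_nat (Suc n) powr z))"
    unfolding norm_zeta_term by (rule summable_zeta_terms[OF assms])
  then show ?thesis
    using assms by (simp add: zeta_def zeta_series_def summable_norm_cancel summable_sums)
qed

text \<open>The bound depends on \<open>Re z\<close> only and so is constant along a vertical
  line.\<close>

lemma norm_zeta_le:
  assumes "Re z > 1"
  shows "norm (zeta z) \<le> (\<Sum>n. real (Suc n) powr (- Re z))"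
proof -
  have "norm (\<Sum>n. 1 / of_nat (Suc n) powr z) \<le> (\<Sum>n. norm (1 / of_nat (Suc n) powr z))"
    by (rule summable_norm) (unfold norm_zeta_term, rule summable_zeta_terms[OF assms])
  then show ?thesis
    unfolding norm_zeta_term using sums_unique[OF zeta_sums[OF assms]] by simp
qed

text \<open>Geometric series in \<open>exp (- y)\<close> without its constant term.\<close>

lemma bose_sums:
  fixes y :: real
  assumes "y > 0"
  shows "(\<lambda>n. exp (- (real (Suc n) * y))) sums (1 / (exp y - 1))"
proof -
  have "(\<lambda>n. exp (- y) * exp (- y) ^ n) sums (exp (- y) * (1 / (1 - exp (- y))))"
    using assms by (intro sums_mult geometric_sums) simp
  moreover have "exp (- y) * exp (- y) ^ n = exp (- (real (Suc n) * y))" for n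
    using exp_of_nat_mult[of "Suc n" "- y"] by simp
  moreover have "exp (- y) * (1 / (1 - exp (- y))) = 1 / (exp y - 1)"
    using assms by (simp add: exp_minus field_simps)
  ultimately show ?thesis by simp
qed

text \<open>Termwise integration of the geometric series: index \<open>n\<close> contributes
  \<open>Gamma z / (n + 1) powr z\<close>. The interchange holds because the L1 norms add up to
  \<open>Gamma (Re z)\<close> times a series that converges for \<open>Re z > 1\<close>.\<close>

lemma bose_mellin:
  fixes z :: complex
  assumes z: "Re z > 1"
  shows "integrable lborel (\<lambda>v. exp (z * of_real v) * of_real (1 / (exp (exp v) - 1)))" (is ?int)
    and "(LBINT v. exp (z * of_real v) * of_real (1 / (exp (exp v) - 1))) = zeta z * Gamma z" (is ?eq)
proof -
  let ?f = "\<lambda>n v. exp (z * of_real v) * complex_of_real (exp (- (real (Suc n) * exp v)))"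
  have z0: "Re z > 0" using z by simp
  have int: "integrable lborel (?f n)" for n
    by (rule Gamma_exp_integral(1)[OF z0]) simp
  have sums: "(\<lambda>n. ?f n v) sums (exp (z * of_real v) * of_real (1 / (exp (exp v) - 1)))" for v
    by (intro sums_mult sums_of_real bose_sums) simp
  have AE: "AE v in lborel. summable (\<lambda>n. norm (?f n v))"
    using bose_sums[THEN sums_summable] by (auto simp: norm_mult simp del: of_nat_Suc)
  have "(LBINT v. norm (?f n v)) = Gamma (Re z) * real (Suc n) powr (- Re z)" for n
    using real_Gamma_exp_integral[of "Re z" "real (Suc n)"] z0
    by (simp add: norm_mult powr_minus_divide del: of_nat_Suc)
  then have summ: "summable (\<lambda>n. LBINT v. norm (?f n v))"
    by (simp add: summable_mult summable_zeta_terms[OF z] del: of_nat_Suc)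
  have suminf: "(\<lambda>v. \<Sum>n. ?f n v) = (\<lambda>v. exp (z * of_real v) * of_real (1 / (exp (exp v) - 1)))"
    using sums_unique[OF sums] by (intro ext) simp
  show ?int
    using integrable_suminf[OF int AE summ] unfolding suminf .
  have "(LBINT v. ?f n v) = 1 / of_nat (Suc n) powr z * Gamma z" for n
    using Gamma_exp_integral(2)[OF z0, of "real (Suc n)"] by simp
  then have "(\<lambda>n. 1 / of_nat (Suc n) powr z * Gamma z) sums
      (LBINT v. exp (z * of_real v) * of_real (1 / (exp (exp v) - 1)))"
    using sums_integral[OF int AE summ] unfolding suminf by simp
  moreover have "(\<lambda>n. 1 / of_nat (Suc n) powr z * Gamma z) sums (zeta z * Gamma z)"
    by (intro sums_mult2 zeta_sums z)
  ultimately show ?eq by (rule sums_unique2)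
qed

section \<open>Boundedness and integrability needed for the inversion\<close>

text \<open>Uniform bound for \<open>fourier_inversion\<close>. In terms of
  \<open>x = exp v\<close>, the denominator \<open>exp x - 1\<close> is bounded below by
  \<open>x\<close> when \<open>x \<le> 1\<close>, and by a single term of the exponential series
  when \<open>x > 1\<close>.\<close>

lemma powr_over_exp_minus_one_le:
  fixes c v :: real
  assumes "c \<ge> 1"
  shows "exp (c * v) * (1 / (exp (exp v) - 1)) \<le> fact (nat \<lceil>c\<rceil>)"
proof -
  define n where "n = nat \<lceil>c\<rceil>"
  have n: "n \<ge> 1" "c \<le> real n" using assms unfolding n_def by linarith+
  have f1: "(1::real) \<le> fact n" by (rule fact_ge_1)
  have pos: "exp (exp v) - 1 > 0" by simp
  have "exp (c * v) \<le> fact n * (exp (exp v) - 1)"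
  proof (cases "v \<le> 0")
    case True
    have "exp (c * v) \<le> exp v"
      using True assms mult_right_mono_neg[of 1 c v] by simp
    also have "\<dots> \<le> exp (exp v) - 1"
      using exp_ge_add_one_self[of "exp v"] by linarith
    also have "\<dots> \<le> fact n * (exp (exp v) - 1)"
      using f1 pos mult_right_mono[of 1 "fact n" "exp (exp v) - 1"] by simp
    finally show ?thesis .
  next
    case False
    have "exp (c * v) \<le> exp (real n * v)"
      using False n by (simp add: mult_right_mono)
    also have "\<dots> = exp v ^ n" by (simp add: exp_of_nat_mult)
    also have "\<dots> = fact n * (exp v ^ n / fact n)" by simp
    also have "exp v ^ n / fact n \<le> exp (exp v) - 1"
    proof -
      \<comment> \<open>As \<open>n \<ge> 1\<close>, the indices 0 and \<open>n\<close> are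
        distinct; the term at 0 accounts for the 1 that is subtracted.\<close>
      have "(\<Sum>k\<in>{0, n}. exp v ^ k / fact k) \<le> exp (exp v)"
        using sum_le_suminf[of "\<lambda>k. exp v ^ k / fact k" "{0, n}"] exp_converges[of "exp v"]
        by (simp add: sums_iff divide_inverse mult.commute)
      then show ?thesis using n by simp
    qed
    finally show ?thesis by (simp add: mult_left_mono)
  qed
  then show ?thesis using pos unfolding n_def by (simp add: field_simps)
qed

text \<open>A constant bound for zeta times the quadratic decay of Gamma gives an integrable
  majorant, so the transform can be inverted.\<close>

lemma bose_mellin_vertical_integrable:
  fixes c :: real
  assumes "c > 1"
  shows "integrable lborel (\<lambda>t. zeta (Complex c t) * Gamma (Complex c t))"
proof (rule Bochner_Integration.integrable_bound)
  let ?Z = "\<Sum>n. real (Suc n) powr (- c)"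
  show "integrable lborel (\<lambda>t. ?Z * (Gamma (c + 2) * inverse (1 + t\<^sup>2)))"
    using integrable_inverse_1_plus_square by (simp add: set_integrable_def)
  \<comment> \<open>Written as an integral with parameter \<open>t\<close>, the product is
    measurable in \<open>t\<close>.\<close>
  have eq: "zeta (Complex c t) * Gamma (Complex c t) =
      (LBINT v. exp (Complex c t * of_real v) * of_real (1 / (exp (exp v) - 1)))" for t
    using bose_mellin(2)[of "Complex c t"] assms by simp
  have [measurable]: "(\<lambda>t. Complex c t) \<in> borel_measurable borel"
    by (simp add: Complex_eq)
  show "(\<lambda>t. zeta (Complex c t) * Gamma (Complex c t)) \<in> borel_measurable lborel"
    unfolding eq by measurable
  have "norm (zeta (Complex c t)) * norm (Gamma (Complex c t)) \<le>
      ?Z * (Gamma (c + 2) * inverse (1 + t\<^sup>2))" for t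
    using norm_zeta_le[of "Complex c t"] norm_Gamma_vertical_le[of c t] assms
    by (intro mult_mono) (auto intro: order_trans[OF norm_ge_zero])
  then show "AE t in lborel. norm (zeta (Complex c t) * Gamma (Complex c t)) \<le>
      norm (?Z * (Gamma (c + 2) * inverse (1 + t\<^sup>2)))"
    unfolding norm_mult[of "zeta _"] real_norm_def by (intro AE_I2 order_trans[OF _ abs_ge_self])
qed

section \<open>The coth identity and Parseval's formula\<close>

text \<open>With \<open>q = exp (x / 2)\<close>, adding 1 to \<open>(q^2 + 1) / (q^2 - 1)\<close>
  gives \<open>2 * q^2 / (q^2 - 1)\<close>, whose numerator cancels
  \<open>2 * exp x\<close>.\<close>

lemma coth_half_plus_one:
  fixes x :: real
  assumes "x > 0"
  shows "(coth (x / 2) + 1) / (2 * exp x * (exp x - 1)) = (1 / (exp x - 1))\<^sup>2"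
proof -
  define q where "q = exp (x / 2)"
  have q: "q > 1" "exp x = q\<^sup>2"
    using assms unfolding q_def by (simp_all flip: exp_of_nat_mult)
  then have q2: "q\<^sup>2 > 1" by (simp add: one_less_power)
  have "(a / 2) / (b / 2) = a / b" for a b :: real
    by simp
  then have "coth (x / 2) = (q + inverse q) / (q - inverse q)"
    unfolding coth_def cosh_field_def sinh_field_def q_def exp_minus by (simp only:)
  also have "\<dots> = (q\<^sup>2 + 1) / (q\<^sup>2 - 1)"
    using q q2 by (simp add: divide_simps power2_eq_square)
  also have "\<dots> + 1 = 2 * q\<^sup>2 / (q\<^sup>2 - 1)"
    using q2 by (simp add: field_simps)
  finally show ?thesis
    unfolding q(2) using q q2 by (simp add: power2_eq_square)
qed

text \<open>Integrability is asserted on both sides because the integral of a non-integrable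
  function defaults to 0, so the bare equation could be void of meaning.\<close>

theorem mainTheorem3:
  fixes s :: complex and c :: real
  assumes "Re s > 2" and "c > 1" and "Re s - c > 1"
  shows "vertical_line_integrable c (\<lambda>z. zeta z * zeta (s - z) * Gamma z * Gamma (s - z)) \<and>
         interval_lebesgue_integrable lborel 0 \<infinity>
           (\<lambda>x. complex_of_real x powr (s - 1) * complex_of_real (coth (x / 2) + 1) /
                complex_of_real (2 * exp x * (exp x - 1))) \<and>
         1 / (2 * complex_of_real pi * \<i>) *
           vertical_line_integral c (\<lambda>z. zeta z * zeta (s - z) * Gamma z * Gamma (s - z)) =
         (LBINT x=0..\<infinity>.
           complex_of_real x powr (s - 1) * complex_of_real (coth (x / 2) + 1) /
           complex_of_real (2 * exp x * (exp x - 1)))"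
proof -
  \<comment> \<open>In the variable \<open>v = ln x\<close>, \<open>h\<close> and \<open>g\<close>
    are the Mellin integrands at \<open>c\<close> and \<open>s - c\<close>, both with real part
    greater than 1.\<close>
  define k where "k v = 1 / (exp (exp v) - 1)" for v :: real
  define h where "h v = exp (of_real c * of_real v) * complex_of_real (k v)" for v
  define g where "g v = exp ((s - c) * of_real v) * of_real (k v)" for v
  define \<phi> where "\<phi> t = zeta (Complex c t) * Gamma (Complex c t)" for t
  define \<psi> where "\<psi> t = zeta (s - Complex c t) * Gamma (s - Complex c t)" for t
  define f where "f x = complex_of_real x powr (s - 1) * complex_of_real (coth (x / 2) + 1) /
    complex_of_real (2 * exp x * (exp x - 1))" for x
  have h: "integrable lborel h"
    using bose_mellin(1)[of "of_real c"] assms by (simp add: h_def[abs_def] k_def)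
  have g: "integrable lborel g"
    using bose_mellin(1)[of "s - of_real c"] assms by (simp add: g_def[abs_def] k_def)
  have \<phi>: "integrable lborel \<phi>"
    using bose_mellin_vertical_integrable[OF assms(2)] by (simp add: \<phi>_def[abs_def])
  have [measurable]: "g \<in> borel_measurable borel" "\<phi> \<in> borel_measurable borel"
    using borel_measurable_integrable[OF g] borel_measurable_integrable[OF \<phi>] by simp_all
  have \<phi>_eq: "\<phi> = (\<lambda>t. LBINT v. iexp (t * v) * h v)"
  proof
    fix t
    have "exp (Complex c t * of_real v) = iexp (t * v) * exp (of_real c * of_real v)" for v
      by (simp add: Complex_eq algebra_simps flip: exp_add)
    then show "\<phi> t = (LBINT v. iexp (t * v) * h v)"
      using bose_mellin(2)[of "Complex c t"] assms
      by (simp add: \<phi>_def h_def k_def mult.assoc)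
  qed
  \<comment> \<open>Since \<open>z\<close> enters through \<open>s - z\<close>, the phase is
    opposite to that of \<open>\<phi>\<close>; it becomes the kernel of the inverse
    transform.\<close>
  have \<psi>_eq: "\<psi> t = (LBINT v. iexp (- (t * v)) * g v)" for t
  proof -
    have "exp ((s - Complex c t) * of_real v) = iexp (- (t * v)) * exp ((s - c) * of_real v)" for v
      by (simp add: Complex_eq algebra_simps flip: exp_add)
    then show ?thesis
      using bose_mellin(2)[of "s - Complex c t"] assms
      by (simp add: \<psi>_def g_def k_def mult.assoc)
  qed
  have inv: "(LBINT t. \<phi> t * iexp (- (t * v))) = 2 * of_real pi * h v" for v
    unfolding \<phi>_eq
  proof (rule fourier_inversion[OF h])
    show "norm (h v) \<le> fact (nat \<lceil>c\<rceil>)" for v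
    proof -
      have "k v \<ge> 0" by (simp add: k_def)
      then show ?thesis
        using powr_over_exp_minus_one_le[of c v, folded k_def] assms by (simp add: h_def norm_mult)
    qed
    show "isCont h v"
      unfolding h_def k_def by (intro continuous_intros) auto
    show "integrable lborel (\<lambda>t. LBINT v. iexp (t * v) * h v)"
      using \<phi> unfolding \<phi>_eq .
  qed
  \<comment> \<open>Integrating over \<open>v\<close> first gives
    \<open>\<phi> t * \<psi> t\<close>; integrating over \<open>t\<close> first gives
    \<open>2 * pi * h v * g v\<close> by Fourier inversion.\<close>
  let ?F = "\<lambda>t v. \<phi> t * (iexp (- (t * v)) * g v)"
  have F: "integrable (lborel \<Otimes>\<^sub>M lborel) (case_prod ?F)"
    by (rule Bochner_Integration.integrable_bound[OF integrable_pair_mult[OF \<phi> g]])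
      (auto simp: norm_mult split_beta')
  have F1: "(LBINT v. ?F t v) = \<phi> t * \<psi> t" for t
    by (simp add: \<psi>_eq)
  have F2: "(LBINT t. ?F t v) = 2 * of_real pi * (h v * g v)" for v
  proof -
    have "(LBINT t. ?F t v) = (LBINT t. \<phi> t * iexp (- (t * v))) * g v"
      unfolding integral_mult_left_zero [symmetric] by (simp only: mult.assoc)
    then show ?thesis unfolding inv by simp
  qed
  \<comment> \<open>The marginals of a jointly integrable function are integrable, so Fubini's
    theorem also yields both integrability claims.\<close>
  have int_\<phi>\<psi>: "integrable lborel (\<lambda>t. \<phi> t * \<psi> t)"
    using lborel_pair.integrable_fst[OF F] unfolding case_prod_conv F1 .
  have "integrable lborel (\<lambda>v. 2 * of_real pi * (h v * g v))"
    using lborel_pair.integrable_snd[OF F] unfolding case_prod_conv F2 .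
  then have "integrable lborel (\<lambda>v. inverse (2 * of_real pi) * (2 * of_real pi * (h v * g v)))"
    by (rule integrable_mult_right)
  then have int_hg: "integrable lborel (\<lambda>v. h v * g v)"
    by (simp flip: mult.assoc)
  have parseval: "(LBINT t. \<phi> t * \<psi> t) = 2 * of_real pi * (LBINT v. h v * g v)"
    using lborel_pair.Fubini_integral[OF F] unfolding F1 F2 by simp
  \<comment> \<open>The Jacobian turns \<open>x powr (s - 1)\<close> into
    \<open>exp (s * v)\<close>, which splits into the exponentials of \<open>h\<close> and
    \<open>g\<close>; the \<open>coth\<close> identity supplies a factor \<open>k v\<close> for
    each.\<close>
  have f_exp: "of_real (exp v) * f (exp v) = h v * g v" for v
  proof -
    have "of_real (exp v) * f (exp v) =
        of_real (exp v) * of_real (exp v) powr (s - 1) *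
        of_real ((coth (exp v / 2) + 1) / (2 * exp (exp v) * (exp (exp v) - 1)))"
      unfolding f_def of_real_divide by simp
    also have "of_real (exp v) * complex_of_real (exp v) powr (s - 1) = exp (s * of_real v)"
      by (simp add: powr_def Ln_of_real algebra_simps flip: exp_of_real exp_add)
    also have "\<dots> = exp (complex_of_real c * of_real v) * exp ((s - c) * of_real v)"
      by (simp add: algebra_simps flip: exp_add)
    also have "(coth (exp v / 2) + 1) / (2 * exp (exp v) * (exp (exp v) - 1)) = k v * k v"
      by (subst coth_half_plus_one) (simp_all add: k_def power2_eq_square)
    finally show ?thesis by (simp add: h_def g_def)
  qed
  have [measurable]: "f \<in> borel_measurable borel"
    unfolding f_def[abs_def] coth_def cosh_def sinh_def by measurable
  have int_f: "set_integrable lborel {0<..} f"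
    using exp_substitution(1)[of f] int_hg by (simp add: f_exp)
  have f_eq: "(LBINT x:{0<..}. f x) = (LBINT v. h v * g v)"
    using exp_substitution(2)[of f] int_hg by (simp add: f_exp)
  have integrand: "zeta (Complex c t) * zeta (s - Complex c t) * Gamma (Complex c t) *
      Gamma (s - Complex c t) * \<i> = \<phi> t * \<psi> t * \<i>" for t
    by (simp add: \<phi>_def \<psi>_def)
  have "vertical_line_integrable c (\<lambda>z. zeta z * zeta (s - z) * Gamma z * Gamma (s - z))"
    using int_\<phi>\<psi> unfolding vertical_line_integrable_def integrand
    by (simp add: interval_lebesgue_integrable_def set_integrable_def einterval_eq)
  \<comment> \<open>The factor \<open>\<i>\<close> from \<open>dz = \<i> dt\<close> and the
    \<open>2 * pi\<close> of Parseval's formula cancel the prefactor.\<close>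
  moreover have "vertical_line_integral c (\<lambda>z. zeta z * zeta (s - z) * Gamma z * Gamma (s - z)) =
      2 * of_real pi * (LBINT x:{0<..}. f x) * \<i>"
    unfolding vertical_line_integral_def integrand f_eq parseval [symmetric]
    by (simp add: interval_lebesgue_integral_def set_lebesgue_integral_def einterval_eq)
  ultimately show ?thesis
    using int_f unfolding interval_lebesgue_integral_0_infty f_def [symmetric] by simp
qed

end
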